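(* Let $G$ be an ordered group. The following properties are equivalent: (i) the order on $G$ is a semiorder; (ii) $I(G)(0)/K(G)$ is a threshold group; (iii) $G/K(G)$ is a threshold group.
   Context: Groups are written additively but are not assumed abelian. An ordered group $G=(X,+,\leq)$ is a group with a partial order preserved by all left and right translations. For an order $\leq$ with strict order $<$, $x\leq_{pred}y$ means that for all $z$, $z<x$ implies $z<y$, and $x\leq_{succ}y$ means that for all $z$, $y<z$ implies $x<z$. A threshold group is an ordered group for which $\leq_{pred}$ and $\leq_{succ}$ are total orders and are equal. $K(G)$ denotes the equivalence class of $0$ for the equivalence relation "$x\leq_{pred}y$ and $y\leq_{pred}x$"; it is a convex normal subgroup of $G$. $I(G)(0)$ denotes the connected component of $0$ in the incomparability graph of $(X,\leq)$ (whose edges are the pairs of incomparable elements); it is a convex normal subgroup of $G$ containing $K(G)$. For a convex normal subgroup $H$ the quotient by $H$ is ordered by the image order: $a'\leq_H b'$ if $a\leq b$ for some $a\in a'$, $b\in b'$. An order is a semiorder if it embeds neither $2\oplus 2$ nor $3\oplus 1$, where $r\oplus s$ is the disjoint union of an $r$-element chain and an $s$-element chain with no comparabilities between them. *)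

theory Defs
  imports "HOL-Algebra.Coset"
begin

text \<open>
  An order on a set \<open>X\<close> is a relation \<open>r \<subseteq> X \<times> X\<close> with \<^const>\<open>partial_order_on\<close>; \<open>(x, y) \<in> r\<close> means
  \<open>x \<le> y\<close>, and the strict order is \<open>r - Id\<close>.
  Groups are written multiplicatively here and are not assumed commutative: the neutral
  element \<open>\<one>\<close> of the monoid record plays the role of \<open>0\<close>.
\<close>

locale ordered_group = group G for G (structure) +
  fixes r :: "'a rel"
  assumes order: "partial_order_on (carrier G) r"
    and translate_left:
      "\<lbrakk>a \<in> carrier G; (x, y) \<in> r\<rbrakk> \<Longrightarrow> (a \<otimes> x, a \<otimes> y) \<in> r"
    and translate_right:
      "\<lbrakk>a \<in> carrier G; (x, y) \<in> r\<rbrakk> \<Longrightarrow> (x \<otimes> a, y \<otimes> a) \<in> r"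

definition pred_rel :: "'a set \<Rightarrow> 'a rel \<Rightarrow> 'a rel" where
  "pred_rel X r = {(x, y) \<in> X \<times> X. \<forall>z\<in>X. (z, x) \<in> r - Id \<longrightarrow> (z, y) \<in> r - Id}"

definition succ_rel :: "'a set \<Rightarrow> 'a rel \<Rightarrow> 'a rel" where
  "succ_rel X r = {(x, y) \<in> X \<times> X. \<forall>z\<in>X. (y, z) \<in> r - Id \<longrightarrow> (x, z) \<in> r - Id}"

text \<open>\<^const>\<open>linear_order_on\<close> includes antisymmetry, so the two relations below are genuine
  total orders and not merely total preorders.\<close>

locale threshold_group = ordered_group +
  assumes pred_linear: "linear_order_on (carrier G) (pred_rel (carrier G) r)"
    and succ_linear: "linear_order_on (carrier G) (succ_rel (carrier G) r)"
    and pred_eq_succ: "pred_rel (carrier G) r = succ_rel (carrier G) r"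

definition pred_kernel :: "('a, 'b) monoid_scheme \<Rightarrow> 'a rel \<Rightarrow> 'a set" where
  "pred_kernel G r = (pred_rel (carrier G) r \<inter> (pred_rel (carrier G) r)\<inverse>) `` {\<one>\<^bsub>G\<^esub>}"

definition incomparability :: "'a set \<Rightarrow> 'a rel \<Rightarrow> 'a rel" where
  "incomparability X r = {(x, y) \<in> X \<times> X. (x, y) \<notin> r \<and> (y, x) \<notin> r}"

definition incomparability_component :: "'a set \<Rightarrow> 'a rel \<Rightarrow> 'a \<Rightarrow> 'a set" where
  "incomparability_component X r x = (incomparability X r)\<^sup>* `` {x}"

definition quotient_order :: "('a, 'b) monoid_scheme \<Rightarrow> 'a set \<Rightarrow> 'a rel \<Rightarrow> 'a set rel" where
  "quotient_order G H r =
     {(A, B) \<in> carrier (G Mod H) \<times> carrier (G Mod H). \<exists>a\<in>A. \<exists>b\<in>B. (a, b) \<in> r}"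

definition order_embeds :: "'a set \<Rightarrow> 'a rel \<Rightarrow> 'b set \<Rightarrow> 'b rel \<Rightarrow> bool" where
  "order_embeds A r B s \<longleftrightarrow>
     (\<exists>f. f \<in> A \<rightarrow> B \<and> inj_on f A \<and> (\<forall>x\<in>A. \<forall>y\<in>A. (x, y) \<in> r \<longleftrightarrow> (f x, f y) \<in> s))"

text \<open>The poset \<open>m \<oplus> n\<close>: disjoint union of the chains \<open>0 < \<dots> < m - 1\<close> and \<open>0 < \<dots> < n - 1\<close>.\<close>

definition two_chains :: "nat \<Rightarrow> nat \<Rightarrow> (nat + nat) set" where
  "two_chains m n = {..<m} <+> {..<n}"

definition two_chains_order :: "nat \<Rightarrow> nat \<Rightarrow> (nat + nat) rel" where
  "two_chains_order m n =
     {(Inl i, Inl j) | i j. i \<le> j \<and> j < m} \<union> {(Inr i, Inr j) | i j. i \<le> j \<and> j < n}"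

definition semiorder_on :: "'a set \<Rightarrow> 'a rel \<Rightarrow> bool" where
  "semiorder_on X r \<longleftrightarrow> partial_order_on X r \<and>
     \<not> order_embeds (two_chains 2 2) (two_chains_order 2 2) X r \<and>
     \<not> order_embeds (two_chains 3 1) (two_chains_order 3 1) X r"

end

theory Submission
  imports Defs
begin

text \<open>
  Write \<open>x \<prec> y\<close> for the strict order and \<open>x \<lesssim> y\<close> for the predecessor preorder. In an ordered group
  it always coincides with the successor preorder (\<open>pred_rel_eq_succ_rel\<close>): if all
  predecessors of \<open>x\<close> precede \<open>y\<close> and \<open>y \<prec> z\<close>, then \<open>x z\<inverse> y\<close> is a predecessor of \<open>x\<close>, hence of \<open>y\<close>,
  and cancelling \<open>z\<inverse> y\<close> gives \<open>x \<prec> z\<close>. All three properties of the theorem then turn out to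
  be equivalent to totality of \<open>\<lesssim>\<close> on the whole group.

  For the semiorder property (\<open>semiorder_iff_pred_total\<close>), two elements not comparable under
  \<open>\<lesssim>\<close>, with witnesses, are the same thing as a copy of \<open>2 \<oplus> 2\<close>, and a copy of \<open>3 \<oplus> 1\<close> contains two
  such elements because \<open>\<lesssim>\<close> compares upper bounds as well as lower bounds.

  For the quotient by the kernel \<open>K\<close> (\<open>threshold_quotient_iff_pred_total\<close>), the cosets of \<open>K\<close> are
  the classes of the equivalence associated with \<open>\<lesssim>\<close>, and \<open>\<prec>\<close> respects these classes. So \<open>\<lesssim>\<close> on the
  quotient is the image of \<open>\<lesssim>\<close>; it is antisymmetric there, and the only condition left
  is totality.

  For the component \<open>I\<close> of the neutral element, an element outside \<open>I\<close> lies above all of \<open>I\<close> or below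
  all of \<open>I\<close> and so cannot distinguish two elements of \<open>I\<close>. Hence \<open>I\<close>, as an
  ordered group, has the restriction of \<open>\<lesssim>\<close> as its own predecessor preorder and has the same kernel
  \<open>K\<close>, and the result on quotients applies to it. Totality on \<open>I\<close> is as strong as totality on the
  group (\<open>pred_total_unit_component_iff\<close>), since up to translation the only other comparisons are those
  of \<open>\<one>\<close> with elements outside \<open>I\<close>, where \<open>\<le>\<close> already decides.
\<close>

section \<open>The induced preorder of an ordered group\<close>

context ordered_group
begin

definition strictly_below :: "'a \<Rightarrow> 'a \<Rightarrow> bool" (infix "\<prec>" 50) where
  "x \<prec> y \<longleftrightarrow> (x, y) \<in> r - Id"

definition pred_below :: "'a \<Rightarrow> 'a \<Rightarrow> bool" (infix "\<lesssim>" 50) where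
  "x \<lesssim> y \<longleftrightarrow> (x, y) \<in> pred_rel (carrier G) r"

lemma r_carrier: "(x, y) \<in> r \<Longrightarrow> x \<in> carrier G \<and> y \<in> carrier G"
  using order by (auto simp: partial_order_on_def preorder_on_def)

lemma r_refl: "x \<in> carrier G \<Longrightarrow> (x, x) \<in> r"
  using order by (auto simp: partial_order_on_def preorder_on_def refl_on_def)

lemma r_iff_strict: "x \<in> carrier G \<Longrightarrow> (x, y) \<in> r \<longleftrightarrow> x = y \<or> x \<prec> y"
  using r_refl by (auto simp: strictly_below_def)

lemma strict_carrier: "x \<prec> y \<Longrightarrow> x \<in> carrier G \<and> y \<in> carrier G"
  by (auto simp: strictly_below_def dest: r_carrier)

lemma strict_irrefl [simp]: "\<not> x \<prec> x"
  by (simp add: strictly_below_def)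

lemma strict_trans: "x \<prec> y \<Longrightarrow> y \<prec> z \<Longrightarrow> x \<prec> z"
  using order unfolding strictly_below_def partial_order_on_def preorder_on_def
  by (auto elim: transE dest: antisymD)

lemma strict_translate_left: "a \<in> carrier G \<Longrightarrow> x \<prec> y \<Longrightarrow> a \<otimes> x \<prec> a \<otimes> y"
  using translate_left[of a x y] Units_l_cancel[of a x y] strict_carrier[of x y]
  by (auto simp: strictly_below_def)

lemma strict_translate_right: "a \<in> carrier G \<Longrightarrow> x \<prec> y \<Longrightarrow> x \<otimes> a \<prec> y \<otimes> a"
  using translate_right[of a x y] right_cancel[of a x y] strict_carrier[of x y]
  by (auto simp: strictly_below_def)

lemma strict_left_iff:
  assumes "a \<in> carrier G" "x \<in> carrier G" "y \<in> carrier G"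
  shows "a \<otimes> x \<prec> a \<otimes> y \<longleftrightarrow> x \<prec> y"
  using strict_translate_left[of a x y] strict_translate_left[of "inv a" "a \<otimes> x" "a \<otimes> y"] assms
  by (auto simp: m_assoc[symmetric])

lemma strict_right_iff:
  assumes "a \<in> carrier G" "x \<in> carrier G" "y \<in> carrier G"
  shows "x \<otimes> a \<prec> y \<otimes> a \<longleftrightarrow> x \<prec> y"
  using strict_translate_right[of a x y] strict_translate_right[of "inv a" "x \<otimes> a" "y \<otimes> a"] assms
  by (auto simp: m_assoc)

lemma pred_below_iff:
  "x \<lesssim> y \<longleftrightarrow> x \<in> carrier G \<and> y \<in> carrier G \<and> (\<forall>z. z \<prec> x \<longrightarrow> z \<prec> y)"
  using r_carrier by (auto simp: pred_below_def pred_rel_def strictly_below_def)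

lemma pred_below_carrier: "x \<lesssim> y \<Longrightarrow> x \<in> carrier G \<and> y \<in> carrier G"
  by (simp add: pred_below_iff)

lemma pred_below_refl: "x \<in> carrier G \<Longrightarrow> x \<lesssim> x"
  by (simp add: pred_below_iff)

lemma pred_below_trans: "x \<lesssim> y \<Longrightarrow> y \<lesssim> z \<Longrightarrow> x \<lesssim> z"
  by (simp add: pred_below_iff)

lemma strict_imp_pred_below: "x \<prec> y \<Longrightarrow> x \<lesssim> y"
  using strict_carrier strict_trans by (auto simp: pred_below_iff)

lemma strict_pred_trans: "x \<prec> y \<Longrightarrow> y \<lesssim> z \<Longrightarrow> x \<prec> z"
  by (simp add: pred_below_iff)

text \<open>If \<open>y \<prec> z\<close>, then \<open>x z\<inverse> y \<prec> x\<close>, and so \<open>x \<lesssim> y\<close> gives \<open>x z\<inverse> y \<prec> y\<close>; cancelling \<open>z\<inverse> y\<close> yields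
  \<open>x \<prec> z\<close>. This is where translations on both sides are used.\<close>

lemma pred_strict_trans:
  assumes "x \<lesssim> y" "y \<prec> z"
  shows "x \<prec> z"
proof -
  have c: "x \<in> carrier G" "y \<in> carrier G" "z \<in> carrier G"
    using assms strict_carrier pred_below_carrier by blast+
  let ?w = "inv z \<otimes> y"
  have "x \<otimes> ?w \<prec> x \<otimes> \<one>"
    using strict_translate_left[of "x \<otimes> inv z" y z] assms(2) c by (simp add: m_assoc)
  then have "x \<otimes> ?w \<prec> y"
    using assms(1) strict_pred_trans c by simp
  moreover have "z \<otimes> ?w = y"
    using c by (simp add: m_assoc[symmetric])
  ultimately show ?thesis
    using strict_right_iff[of ?w x z] c by simp
qed

text \<open>The order-dual of the previous computation.\<close>

lemma succ_below_imp_pred_below: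
  assumes c: "x \<in> carrier G" "y \<in> carrier G" and up: "\<And>w. y \<prec> w \<Longrightarrow> x \<prec> w"
  shows "x \<lesssim> y"
proof -
  have "z \<prec> y" if "z \<prec> x" for z
  proof -
    have z: "z \<in> carrier G"
      using that strict_carrier by blast
    let ?w = "inv z \<otimes> x"
    have "y \<otimes> \<one> \<prec> y \<otimes> ?w"
      using strict_translate_left[of "y \<otimes> inv z" z x] that c z by (simp add: m_assoc)
    then have "x \<prec> y \<otimes> ?w"
      using up c by simp
    moreover have "z \<otimes> ?w = x"
      using c z by (simp add: m_assoc[symmetric])
    ultimately show ?thesis
      using strict_right_iff[of ?w z y] c z by simp
  qed
  then show ?thesis
    using c by (simp add: pred_below_iff)
qed

lemma pred_rel_eq_succ_rel: "pred_rel (carrier G) r = succ_rel (carrier G) r"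
proof -
  have "(x, y) \<in> succ_rel (carrier G) r \<longleftrightarrow>
      x \<in> carrier G \<and> y \<in> carrier G \<and> (\<forall>w. y \<prec> w \<longrightarrow> x \<prec> w)" for x y
    using r_carrier by (auto simp: succ_rel_def strictly_below_def)
  then have "(x, y) \<in> succ_rel (carrier G) r \<longleftrightarrow> x \<lesssim> y" for x y
    using pred_strict_trans pred_below_carrier succ_below_imp_pred_below by metis
  then show ?thesis
    by (auto simp: pred_below_def)
qed

lemma pred_translate_left:
  assumes "a \<in> carrier G" "x \<lesssim> y"
  shows "a \<otimes> x \<lesssim> a \<otimes> y"
proof -
  have c: "x \<in> carrier G" "y \<in> carrier G"
    using assms pred_below_carrier by blast+
  have "z \<prec> a \<otimes> y" if "z \<prec> a \<otimes> x" for z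
  proof -
    have z: "a \<otimes> (inv a \<otimes> z) = z" "inv a \<otimes> z \<in> carrier G"
      using strict_carrier[OF that] assms(1) by (auto simp: m_assoc[symmetric])
    then show ?thesis
      using strict_left_iff[OF assms(1) z(2)] that c strict_pred_trans[OF _ assms(2)] by metis
  qed
  then show ?thesis
    using assms(1) c by (simp add: pred_below_iff)
qed

lemma pred_translate_right:
  assumes "a \<in> carrier G" "x \<lesssim> y"
  shows "x \<otimes> a \<lesssim> y \<otimes> a"
proof -
  have c: "x \<in> carrier G" "y \<in> carrier G"
    using assms pred_below_carrier by blast+
  have "z \<prec> y \<otimes> a" if "z \<prec> x \<otimes> a" for z
  proof -
    have z: "(z \<otimes> inv a) \<otimes> a = z" "z \<otimes> inv a \<in> carrier G"
      using strict_carrier[OF that] assms(1) by (auto simp: m_assoc)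
    then show ?thesis
      using strict_right_iff[OF assms(1) z(2)] that c strict_pred_trans[OF _ assms(2)] by metis
  qed
  then show ?thesis
    using assms(1) c by (simp add: pred_below_iff)
qed

lemma pred_right_iff:
  assumes "a \<in> carrier G" "x \<in> carrier G" "y \<in> carrier G"
  shows "x \<otimes> a \<lesssim> y \<otimes> a \<longleftrightarrow> x \<lesssim> y"
  using pred_translate_right[of a x y] pred_translate_right[of "inv a" "x \<otimes> a" "y \<otimes> a"] assms
  by (auto simp: m_assoc)

lemma pred_total_on_iff:
  "total_on (carrier G) (pred_rel (carrier G) r) \<longleftrightarrow>
     (\<forall>x\<in>carrier G. \<forall>y\<in>carrier G. x \<lesssim> y \<or> y \<lesssim> x)"
  using pred_below_refl unfolding total_on_def pred_below_def by metis

section \<open>Semiorders\<close>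

text \<open>The four relations on the right force all the incomparabilities of \<open>2 \<oplus> 2\<close>: any relation \<open>\<le>\<close>
  between the two chains would, by transitivity, give \<open>a \<prec> d\<close> or \<open>c \<prec> b\<close>.\<close>

lemma embeds_two_two_iff:
  "order_embeds (two_chains 2 2) (two_chains_order 2 2) (carrier G) r \<longleftrightarrow>
     (\<exists>a b c d. a \<prec> b \<and> c \<prec> d \<and> \<not> a \<prec> d \<and> \<not> c \<prec> b)" (is "?L \<longleftrightarrow> ?R")
proof
  assume ?L
  then obtain f where f: "f \<in> two_chains 2 2 \<rightarrow> carrier G" "inj_on f (two_chains 2 2)"
    and ord: "\<And>x y. x \<in> two_chains 2 2 \<Longrightarrow> y \<in> two_chains 2 2 \<Longrightarrow>
      (x, y) \<in> two_chains_order 2 2 \<longleftrightarrow> (f x, f y) \<in> r"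
    unfolding order_embeds_def by blast
  have mem: "Inl 0 \<in> two_chains 2 2" "Inl 1 \<in> two_chains 2 2"
    "Inr 0 \<in> two_chains 2 2" "Inr 1 \<in> two_chains 2 2"
    by (auto simp: two_chains_def)
  have "f (Inl 0) \<prec> f (Inl 1)" "f (Inr 0) \<prec> f (Inr 1)"
    "\<not> f (Inl 0) \<prec> f (Inr 1)" "\<not> f (Inr 0) \<prec> f (Inl 1)"
    using mem f(2) by (auto simp: strictly_below_def ord[symmetric] two_chains_order_def dest: inj_onD)
  then show ?R
    by blast
next
  assume ?R
  then obtain a b c d where *: "a \<prec> b" "c \<prec> d" "\<not> a \<prec> d" "\<not> c \<prec> b"
    by blast
  have car: "a \<in> carrier G" "b \<in> carrier G" "c \<in> carrier G" "d \<in> carrier G"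
    using * strict_carrier by blast+
  have sep: "(a, b) \<in> r" "(c, d) \<in> r" "(b, a) \<notin> r" "(d, c) \<notin> r"
    "(a, c) \<notin> r" "(a, d) \<notin> r" "(b, c) \<notin> r" "(b, d) \<notin> r"
    "(c, a) \<notin> r" "(c, b) \<notin> r" "(d, a) \<notin> r" "(d, b) \<notin> r"
    using * car strict_trans strict_irrefl by (metis r_iff_strict)+
  let ?f = "case_sum (\<lambda>i. if i = 0 then a else b) (\<lambda>i. if i = 0 then c else d)"
  have chains: "two_chains 2 2 = {Inl 0, Inl 1, Inr 0, Inr 1}"
    by (auto simp: two_chains_def less_2_cases_iff)
  show ?L
    unfolding order_embeds_def
  proof (intro exI conjI)
    show "?f \<in> two_chains 2 2 \<rightarrow> carrier G"
      using car by (auto simp: chains)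
    show "inj_on ?f (two_chains 2 2)"
      using sep car r_refl by (auto simp: chains)
    show "\<forall>x\<in>two_chains 2 2. \<forall>y\<in>two_chains 2 2.
        (x, y) \<in> two_chains_order 2 2 \<longleftrightarrow> (?f x, ?f y) \<in> r"
      using sep car r_refl by (auto simp: chains two_chains_order_def)
  qed
qed

lemma embeds_three_one_imp:
  assumes "order_embeds (two_chains 3 1) (two_chains_order 3 1) (carrier G) r"
  obtains a b c d where "a \<prec> b" "b \<prec> c" "d \<in> carrier G" "\<not> a \<prec> d" "\<not> d \<prec> c"
proof -
  obtain f where f: "f \<in> two_chains 3 1 \<rightarrow> carrier G" "inj_on f (two_chains 3 1)"
    and ord: "\<And>x y. x \<in> two_chains 3 1 \<Longrightarrow> y \<in> two_chains 3 1 \<Longrightarrow>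
      (x, y) \<in> two_chains_order 3 1 \<longleftrightarrow> (f x, f y) \<in> r"
    using assms unfolding order_embeds_def by blast
  have mem: "Inl 0 \<in> two_chains 3 1" "Inl 1 \<in> two_chains 3 1"
    "Inl 2 \<in> two_chains 3 1" "Inr 0 \<in> two_chains 3 1"
    by (auto simp: two_chains_def)
  have "f (Inl 0) \<prec> f (Inl 1)" "f (Inl 1) \<prec> f (Inl 2)"
    "\<not> f (Inl 0) \<prec> f (Inr 0)" "\<not> f (Inr 0) \<prec> f (Inl 2)"
    using mem f(2) by (auto simp: strictly_below_def ord[symmetric] two_chains_order_def dest: inj_onD)
  moreover have "f (Inr 0) \<in> carrier G"
    using f(1) mem by blast
  ultimately show ?thesis
    using that by blast
qed

text \<open>Two elements that are not comparable under \<open>\<lesssim>\<close>, together with witnesses for this, form a copy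
  of \<open>2 \<oplus> 2\<close>, and a copy of \<open>2 \<oplus> 2\<close> gives such a pair. In a copy of \<open>3 \<oplus> 1\<close> with chain
  \<open>a \<prec> b \<prec> c\<close> and isolated point \<open>d\<close>, the element \<open>a\<close> shows that \<open>b \<lesssim> d\<close> fails, and \<open>c\<close> shows that
  \<open>d \<lesssim> b\<close> fails, because \<open>\<lesssim>\<close> also compares the sets of upper bounds.\<close>

theorem semiorder_iff_pred_total:
  "semiorder_on (carrier G) r \<longleftrightarrow> total_on (carrier G) (pred_rel (carrier G) r)"
proof
  assume semi: "semiorder_on (carrier G) r"
  have "x \<lesssim> y \<or> y \<lesssim> x" if xy: "x \<in> carrier G" "y \<in> carrier G" for x y
  proof (rule ccontr)
    assume "\<not> (x \<lesssim> y \<or> y \<lesssim> x)"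
    then obtain z w where "z \<prec> x" "\<not> z \<prec> y" "w \<prec> y" "\<not> w \<prec> x"
      using xy by (auto simp: pred_below_iff)
    then show False
      using semi embeds_two_two_iff by (auto simp: semiorder_on_def)
  qed
  then show "total_on (carrier G) (pred_rel (carrier G) r)"
    by (simp add: pred_total_on_iff)
next
  assume "total_on (carrier G) (pred_rel (carrier G) r)"
  then have total: "x \<lesssim> y \<or> y \<lesssim> x" if "x \<in> carrier G" "y \<in> carrier G" for x y
    using that by (simp add: pred_total_on_iff)
  have "\<not> order_embeds (two_chains 2 2) (two_chains_order 2 2) (carrier G) r"
  proof
    assume "order_embeds (two_chains 2 2) (two_chains_order 2 2) (carrier G) r"
    then obtain a b c d where "a \<prec> b" "c \<prec> d" "\<not> a \<prec> d" "\<not> c \<prec> b"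
      unfolding embeds_two_two_iff by blast
    then have "\<not> b \<lesssim> d" "\<not> d \<lesssim> b" "b \<in> carrier G" "d \<in> carrier G"
      using strict_pred_trans[of a b d] strict_pred_trans[of c d b] strict_carrier by blast+
    then show False
      using total by blast
  qed
  moreover have "\<not> order_embeds (two_chains 3 1) (two_chains_order 3 1) (carrier G) r"
  proof
    assume "order_embeds (two_chains 3 1) (two_chains_order 3 1) (carrier G) r"
    then obtain a b c d where "a \<prec> b" "b \<prec> c" "d \<in> carrier G" "\<not> a \<prec> d" "\<not> d \<prec> c"
      by (rule embeds_three_one_imp)
    then have "\<not> b \<lesssim> d" "\<not> d \<lesssim> b" "b \<in> carrier G" "d \<in> carrier G"
      using strict_pred_trans[of a b d] pred_strict_trans[of d b c] strict_carrier[of a b] by auto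
    then show False
      using total by blast
  qed
  ultimately show "semiorder_on (carrier G) r"
    using order by (simp add: semiorder_on_def)
qed

section \<open>The quotient by the kernel of the preorder\<close>

lemma mem_pred_kernel_iff: "k \<in> pred_kernel G r \<longleftrightarrow> k \<lesssim> \<one> \<and> \<one> \<lesssim> k"
  by (auto simp: pred_kernel_def pred_below_def)

lemma pred_kernel_subgroup: "subgroup (pred_kernel G r) G"
proof (rule subgroupI)
  show "pred_kernel G r \<subseteq> carrier G"
    using pred_below_carrier by (auto simp: mem_pred_kernel_iff)
  show "pred_kernel G r \<noteq> {}"
    using pred_below_refl[of \<one>] mem_pred_kernel_iff by auto
next
  fix k assume "k \<in> pred_kernel G r"
  then have k: "k \<lesssim> \<one>" "\<one> \<lesssim> k" "k \<in> carrier G"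
    using pred_below_carrier by (auto simp: mem_pred_kernel_iff)
  then show "inv k \<in> pred_kernel G r"
    using pred_translate_left[of "inv k" k \<one>] pred_translate_left[of "inv k" \<one> k]
    by (simp add: mem_pred_kernel_iff)
next
  fix k h assume "k \<in> pred_kernel G r" "h \<in> pred_kernel G r"
  then have k: "k \<lesssim> \<one>" "\<one> \<lesssim> k" "k \<in> carrier G" and h: "h \<lesssim> \<one>" "\<one> \<lesssim> h"
    using pred_below_carrier by (auto simp: mem_pred_kernel_iff)
  have "k \<otimes> h \<lesssim> k" "k \<lesssim> k \<otimes> h"
    using pred_translate_left[OF k(3) h(1)] pred_translate_left[OF k(3) h(2)] k(3) by simp_all
  then show "k \<otimes> h \<in> pred_kernel G r"
    unfolding mem_pred_kernel_iff using k(1,2) pred_below_trans by blast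
qed

lemma pred_kernel_normal: "pred_kernel G r \<lhd> G"
proof -
  have "x \<otimes> k \<otimes> inv x \<in> pred_kernel G r" if x: "x \<in> carrier G" and k: "k \<in> pred_kernel G r" for x k
  proof -
    have "k \<lesssim> \<one>" "\<one> \<lesssim> k"
      using k by (auto simp: mem_pred_kernel_iff)
    then have "x \<otimes> k \<lesssim> x \<otimes> \<one>" "x \<otimes> \<one> \<lesssim> x \<otimes> k"
      using x pred_translate_left by blast+
    then show ?thesis
      using pred_translate_right[of "inv x" "x \<otimes> k" x] pred_translate_right[of "inv x" x "x \<otimes> k"] x
      by (simp add: mem_pred_kernel_iff)
  qed
  then show ?thesis
    using pred_kernel_subgroup normal_inv_iff by blast
qed

text \<open>The preorder is invariant under translation by \<open>y\<close>, so \<open>x y\<inverse>\<close> is equivalent to \<open>\<one>\<close> exactly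
  when \<open>x\<close> is equivalent to \<open>y\<close>.\<close>

lemma kernel_coset_eq_iff:
  assumes "x \<in> carrier G" "y \<in> carrier G"
  shows "pred_kernel G r #> x = pred_kernel G r #> y \<longleftrightarrow> x \<lesssim> y \<and> y \<lesssim> x"
proof -
  let ?K = "pred_kernel G r"
  have "?K #> x = ?K #> y \<longleftrightarrow> x \<in> ?K #> y"
    using repr_independence[of x ?K y] rcos_self[of x ?K] assms pred_kernel_subgroup by auto
  also have "\<dots> \<longleftrightarrow> x \<otimes> inv y \<in> ?K"
    using subgroup.rcos_module[OF pred_kernel_subgroup] assms is_group by blast
  also have "\<dots> \<longleftrightarrow> x \<lesssim> y \<and> y \<lesssim> x"
    using pred_right_iff[of y "x \<otimes> inv y" \<one>] pred_right_iff[of y \<one> "x \<otimes> inv y"] assms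
    by (simp add: mem_pred_kernel_iff m_assoc)
  finally show ?thesis .
qed

lemma kernel_coset_neq_if_strict:
  assumes "x \<prec> y"
  shows "pred_kernel G r #> x \<noteq> pred_kernel G r #> y"
proof -
  have "\<not> y \<lesssim> x"
    using strict_pred_trans[OF assms] strict_irrefl by blast
  then show ?thesis
    using kernel_coset_eq_iff strict_carrier[OF assms] by blast
qed

text \<open>The strict order does not depend on the representatives of the cosets: \<open>\<prec>\<close> absorbs \<open>\<lesssim>\<close> on
  either side, and the elements of one coset are pairwise related by \<open>\<lesssim>\<close>.\<close>

lemma quotient_order_iff:
  assumes "x \<in> carrier G" "y \<in> carrier G"
  shows "(pred_kernel G r #> x, pred_kernel G r #> y) \<in> quotient_order G (pred_kernel G r) r \<longleftrightarrow>
      pred_kernel G r #> x = pred_kernel G r #> y \<or> x \<prec> y" (is "?L \<longleftrightarrow> ?R")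
proof
  let ?K = "pred_kernel G r"
  assume ?L
  then obtain a b where ab: "a \<in> ?K #> x" "b \<in> ?K #> y" "(a, b) \<in> r"
    by (auto simp: quotient_order_def)
  have car: "a \<in> carrier G" "b \<in> carrier G"
    using ab(3) r_carrier by blast+
  have eq: "?K #> x = ?K #> a" "?K #> y = ?K #> b"
    using repr_independence[OF ab(1)] repr_independence[OF ab(2)] assms pred_kernel_subgroup
    by blast+
  show ?R
  proof (cases "a = b")
    case True
    then show ?thesis
      using eq by simp
  next
    case False
    then have "a \<prec> b"
      using ab(3) by (simp add: strictly_below_def)
    moreover have "x \<lesssim> a" "b \<lesssim> y"
      using eq kernel_coset_eq_iff assms car by blast+
    ultimately show ?thesis
      using pred_strict_trans strict_pred_trans by blast
  qed
next
  let ?K = "pred_kernel G r"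
  assume ?R
  moreover have "x \<in> ?K #> x" "y \<in> ?K #> y"
    using assms rcos_self pred_kernel_subgroup by blast+
  ultimately have "\<exists>a\<in>?K #> x. \<exists>b\<in>?K #> y. (a, b) \<in> r"
    using r_refl assms by (auto simp: strictly_below_def)
  then show ?L
    using assms by (auto simp: quotient_order_def carrier_FactGroup)
qed

lemma quotient_order_strict_iff:
  assumes "x \<in> carrier G" "y \<in> carrier G"
  shows "(pred_kernel G r #> x, pred_kernel G r #> y) \<in> quotient_order G (pred_kernel G r) r - Id
      \<longleftrightarrow> x \<prec> y"
  using quotient_order_iff[OF assms] kernel_coset_neq_if_strict by auto

lemma quotient_ordered_group:
  "ordered_group (G Mod pred_kernel G r) (quotient_order G (pred_kernel G r) r)"
proof -
  let ?K = "pred_kernel G r" and ?Q = "quotient_order G (pred_kernel G r) r"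
  interpret K: normal ?K G
    by (rule pred_kernel_normal)
  have mult: "(?K #> a) <#> (?K #> x) = ?K #> (a \<otimes> x)" if "a \<in> carrier G" "x \<in> carrier G" for a x
    using that by (rule K.rcos_sum)
  have Q_sub: "?Q \<subseteq> carrier (G Mod ?K) \<times> carrier (G Mod ?K)"
    by (auto simp: quotient_order_def)
  have cosets: "\<exists>x\<in>carrier G. \<exists>y\<in>carrier G. A = ?K #> x \<and> B = ?K #> y" if "(A, B) \<in> ?Q" for A B
    using that by (auto simp: quotient_order_def carrier_FactGroup)
  have refl: "refl_on (carrier (G Mod ?K)) ?Q"
    using quotient_order_iff by (auto simp: refl_on_def carrier_FactGroup)
  have trans: "trans ?Q"
  proof (rule transI)
    fix A B C assume AB: "(A, B) \<in> ?Q" and BC: "(B, C) \<in> ?Q"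
    obtain x y z where xyz: "x \<in> carrier G" "y \<in> carrier G" "z \<in> carrier G"
      "A = ?K #> x" "B = ?K #> y" "C = ?K #> z"
      using cosets[OF AB] cosets[OF BC] by blast
    show "(A, C) \<in> ?Q"
    proof (cases "A = B \<or> B = C")
      case True
      then show ?thesis
        using AB BC by auto
    next
      case False
      then have "x \<prec> y" "y \<prec> z"
        using AB BC quotient_order_iff[of x y] quotient_order_iff[of y z] xyz by simp_all
      then have "x \<prec> z"
        by (rule strict_trans)
      then show ?thesis
        using xyz quotient_order_iff[of x z] by simp
    qed
  qed
  have antisym: "antisym ?Q"
  proof (rule antisymI)
    fix A B assume AB: "(A, B) \<in> ?Q" and BA: "(B, A) \<in> ?Q"
    obtain x y where xy: "x \<in> carrier G" "y \<in> carrier G" "A = ?K #> x" "B = ?K #> y"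
      using cosets[OF AB] by blast
    show "A = B"
      using AB BA quotient_order_iff[of x y] quotient_order_iff[of y x] xy
        strict_trans[of x y x] by auto
  qed
  show ?thesis
  proof (intro ordered_group.intro ordered_group_axioms.intro)
    show "group (G Mod ?K)"
      by (rule K.factorgroup_is_group)
    show "partial_order_on (carrier (G Mod ?K)) ?Q"
      using Q_sub refl trans antisym by (simp add: partial_order_on_def preorder_on_def)
  next
    fix C A B assume C: "C \<in> carrier (G Mod ?K)" and AB: "(A, B) \<in> ?Q"
    obtain c where "c \<in> carrier G" "C = ?K #> c"
      using C by (auto simp: carrier_FactGroup)
    moreover obtain x y where "x \<in> carrier G" "y \<in> carrier G" "A = ?K #> x" "B = ?K #> y"
      using cosets[OF AB] by blast
    ultimately have cxy: "c \<in> carrier G" "x \<in> carrier G" "y \<in> carrier G"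
      "C = ?K #> c" "A = ?K #> x" "B = ?K #> y"
      by blast+
    have "A = B \<or> x \<prec> y"
      using AB cxy quotient_order_iff[of x y] by simp
    then have left: "C <#> A = C <#> B \<or> c \<otimes> x \<prec> c \<otimes> y"
      and right: "A <#> C = B <#> C \<or> x \<otimes> c \<prec> y \<otimes> c"
      using cxy strict_translate_left strict_translate_right by blast+
    show "(C \<otimes>\<^bsub>G Mod ?K\<^esub> A, C \<otimes>\<^bsub>G Mod ?K\<^esub> B) \<in> ?Q"
      using left quotient_order_iff[of "c \<otimes> x" "c \<otimes> y"] cxy by (simp add: mult)
    show "(A \<otimes>\<^bsub>G Mod ?K\<^esub> C, B \<otimes>\<^bsub>G Mod ?K\<^esub> C) \<in> ?Q"
      using right quotient_order_iff[of "x \<otimes> c" "y \<otimes> c"] cxy by (simp add: mult)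
  qed
qed

lemma quotient_pred_rel_iff:
  assumes "x \<in> carrier G" "y \<in> carrier G"
  shows "(pred_kernel G r #> x, pred_kernel G r #> y)
      \<in> pred_rel (carrier (G Mod pred_kernel G r)) (quotient_order G (pred_kernel G r) r) \<longleftrightarrow> x \<lesssim> y"
proof -
  have "(pred_kernel G r #> x, pred_kernel G r #> y)
      \<in> pred_rel (carrier (G Mod pred_kernel G r)) (quotient_order G (pred_kernel G r) r) \<longleftrightarrow>
    (\<forall>z\<in>carrier G. z \<prec> x \<longrightarrow> z \<prec> y)"
    using assms quotient_order_strict_iff
    by (auto simp: pred_rel_def carrier_FactGroup simp del: Diff_iff)
  also have "\<dots> \<longleftrightarrow> x \<lesssim> y"
    using assms strict_carrier by (auto simp: pred_below_iff)
  finally show ?thesis .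
qed

text \<open>Dividing by the kernel makes the preorder antisymmetric and affects neither its agreement with
  the successor preorder, which holds in every ordered group, nor its totality.\<close>

theorem threshold_quotient_iff_pred_total:
  "threshold_group (G Mod pred_kernel G r) (quotient_order G (pred_kernel G r) r) \<longleftrightarrow>
     total_on (carrier G) (pred_rel (carrier G) r)"
proof -
  let ?K = "pred_kernel G r" and ?Q = "quotient_order G (pred_kernel G r) r"
  let ?P = "pred_rel (carrier (G Mod ?K)) ?Q"
  interpret Q: ordered_group "G Mod ?K" ?Q
    by (rule quotient_ordered_group)
  have ball_cosets: "(\<forall>A\<in>carrier (G Mod ?K). \<forall>B\<in>carrier (G Mod ?K). \<Phi> A B) \<longleftrightarrow>
      (\<forall>x\<in>carrier G. \<forall>y\<in>carrier G. \<Phi> (?K #> x) (?K #> y))" for \<Phi>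
    by (auto simp: carrier_FactGroup)
  have total: "total_on (carrier (G Mod ?K)) ?P \<longleftrightarrow> total_on (carrier G) (pred_rel (carrier G) r)"
    unfolding Q.pred_total_on_iff pred_total_on_iff Q.pred_below_def ball_cosets
    by (simp add: quotient_pred_rel_iff)
  have "partial_order_on (carrier (G Mod ?K)) ?P"
    unfolding partial_order_on_def preorder_on_def
  proof (intro conjI)
    show "?P \<subseteq> carrier (G Mod ?K) \<times> carrier (G Mod ?K)"
      by (auto simp: pred_rel_def)
    show "refl_on (carrier (G Mod ?K)) ?P" "trans ?P"
      by (auto simp: pred_rel_def refl_on_def trans_def)
    show "antisym ?P"
    proof (rule antisymI)
      fix A B assume AB: "(A, B) \<in> ?P" "(B, A) \<in> ?P"
      then obtain x y where "x \<in> carrier G" "y \<in> carrier G" "A = ?K #> x" "B = ?K #> y"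
        by (auto simp: pred_rel_def carrier_FactGroup)
      then show "A = B"
        using AB quotient_pred_rel_iff[of x y] quotient_pred_rel_iff[of y x] kernel_coset_eq_iff[of x y]
        by simp
    qed
  qed
  then show ?thesis
    using total Q.pred_rel_eq_succ_rel Q.ordered_group_axioms
    by (auto simp: threshold_group_def threshold_group_axioms_def linear_order_on_def)
qed

section \<open>The incomparability component of the neutral element\<close>

definition unit_component :: "'a set" where
  "unit_component = incomparability_component (carrier G) r \<one>"

lemma unit_component_iff: "x \<in> unit_component \<longleftrightarrow> (\<one>, x) \<in> (incomparability (carrier G) r)\<^sup>*"
  by (simp add: unit_component_def incomparability_component_def)

lemma incomparability_path_carrier:
  "(x, y) \<in> (incomparability (carrier G) r)\<^sup>* \<Longrightarrow> x \<in> carrier G \<Longrightarrow> y \<in> carrier G"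
  by (induction rule: rtrancl_induct) (auto simp: incomparability_def)

lemma incomparability_path_sym:
  "(x, y) \<in> (incomparability (carrier G) r)\<^sup>* \<Longrightarrow> (y, x) \<in> (incomparability (carrier G) r)\<^sup>*"
proof -
  have "sym (incomparability (carrier G) r)"
    by (auto simp: sym_def incomparability_def)
  then show "(x, y) \<in> (incomparability (carrier G) r)\<^sup>* \<Longrightarrow> ?thesis"
    using sym_rtrancl symD by metis
qed

lemma incomparable_iff:
  "(x, y) \<in> incomparability (carrier G) r \<longleftrightarrow>
     x \<in> carrier G \<and> y \<in> carrier G \<and> x \<noteq> y \<and> \<not> x \<prec> y \<and> \<not> y \<prec> x"
  using r_iff_strict[of x y] r_iff_strict[of y x] by (auto simp: incomparability_def)

lemma incomparability_path_translate:
  assumes "(x, y) \<in> (incomparability (carrier G) r)\<^sup>*" "a \<in> carrier G"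
  shows "(a \<otimes> x, a \<otimes> y) \<in> (incomparability (carrier G) r)\<^sup>*"
  using assms(1)
proof (induction rule: rtrancl_induct)
  case (step y z)
  then have "(a \<otimes> y, a \<otimes> z) \<in> incomparability (carrier G) r"
    using assms(2) by (auto simp: incomparable_iff strict_left_iff)
  then show ?case
    using step by auto
qed simp

lemma unit_component_subgroup: "subgroup unit_component G"
proof (rule subgroupI)
  show "unit_component \<subseteq> carrier G"
    using incomparability_path_carrier by (auto simp: unit_component_iff)
  then have car: "a \<in> carrier G" if "a \<in> unit_component" for a
    using that by blast
  show "unit_component \<noteq> {}"
    using unit_component_iff by blast
  show "inv a \<in> unit_component" if "a \<in> unit_component" for a
    using incomparability_path_translate[of \<one> a "inv a"] incomparability_path_sym that car[OF that]
    by (simp add: unit_component_iff)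
  show "a \<otimes> b \<in> unit_component" if "a \<in> unit_component" "b \<in> unit_component" for a b
    using incomparability_path_translate[of \<one> b a] that car rtrancl_trans
    by (fastforce simp: unit_component_iff)
qed

lemma comparable_if_outside_unit_component:
  assumes "x \<in> unit_component" "z \<in> carrier G" "z \<notin> unit_component"
  shows "x \<prec> z \<or> z \<prec> x"
proof -
  have "(x, z) \<notin> incomparability (carrier G) r"
    using assms rtrancl_into_rtrancl unfolding unit_component_iff by metis
  moreover have "x \<in> carrier G"
    using assms(1) incomparability_path_carrier by (auto simp: unit_component_iff)
  ultimately show ?thesis
    using assms by (auto simp: incomparable_iff)
qed

text \<open>An element outside the component is comparable to all of it and cannot change sides along an
  edge \<open>y\<close>, \<open>y'\<close> of the incomparability graph, since \<open>y' \<prec> z \<prec> y\<close> would make \<open>y\<close> and \<open>y'\<close>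
  comparable.\<close>

lemma below_unit_component:
  assumes "x \<in> unit_component" "y \<in> unit_component" "z \<notin> unit_component" "z \<prec> x"
  shows "z \<prec> y"
proof -
  have "(x, y) \<in> (incomparability (carrier G) r)\<^sup>*"
    using assms(1,2) incomparability_path_sym rtrancl_trans unfolding unit_component_iff by metis
  then show ?thesis
  proof (induction rule: rtrancl_induct)
    case base
    show ?case by fact
  next
    case (step y y')
    have "y' \<in> unit_component"
      using step.hyps assms(1) by (auto simp: unit_component_iff)
    then have "y' \<prec> z \<or> z \<prec> y'"
      using comparable_if_outside_unit_component assms(3,4) strict_carrier by blast
    then show ?case
      using step strict_trans by (auto simp: incomparable_iff)
  qed
qed

lemma restricted_ordered_group:
  assumes "subgroup H G"
  shows "ordered_group (G\<lparr>carrier := H\<rparr>) (Restr r H)"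
proof (intro ordered_group.intro ordered_group_axioms.intro)
  show "group (G\<lparr>carrier := H\<rparr>)"
    using assms by (rule subgroup_imp_group)
  have "H \<subseteq> carrier G"
    using assms by (rule subgroup.subset)
  then show "partial_order_on (carrier (G\<lparr>carrier := H\<rparr>)) (Restr r H)"
    using order by (auto simp: partial_order_on_def preorder_on_def refl_on_def
        intro: trans_Restr antisym_subset)
qed (use assms translate_left translate_right in
    \<open>auto dest: subgroup.m_closed subgroup.mem_carrier\<close>)

text \<open>Elements outside the component have the same position relative to \<open>x\<close> and to \<open>y\<close>, so only the
  predecessors inside it matter.\<close>

lemma pred_rel_unit_component_iff:
  assumes "x \<in> unit_component" "y \<in> unit_component"
  shows "(x, y) \<in> pred_rel unit_component (Restr r unit_component) \<longleftrightarrow> x \<lesssim> y"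
proof -
  have car: "x \<in> carrier G" "y \<in> carrier G"
    using assms incomparability_path_carrier by (auto simp: unit_component_iff)
  have "(x, y) \<in> pred_rel unit_component (Restr r unit_component) \<longleftrightarrow>
      (\<forall>z\<in>unit_component. z \<prec> x \<longrightarrow> z \<prec> y)"
    using assms by (auto simp: pred_rel_def strictly_below_def)
  also have "\<dots> \<longleftrightarrow> x \<lesssim> y"
    using car below_unit_component[OF assms] by (auto simp: pred_below_iff)
  finally show ?thesis .
qed

text \<open>An element of the kernel is incomparable or equal to \<open>\<one>\<close>: from \<open>k \<prec> \<one> \<lesssim> k\<close> would follow
  \<open>k \<prec> k\<close>.\<close>

lemma pred_kernel_subset_unit_component: "pred_kernel G r \<subseteq> unit_component"
proof
  fix k assume "k \<in> pred_kernel G r"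
  then have k: "k \<lesssim> \<one>" "\<one> \<lesssim> k"
    by (auto simp: mem_pred_kernel_iff)
  then have "\<not> k \<prec> \<one>" "\<not> \<one> \<prec> k" "k \<in> carrier G"
    using strict_pred_trans strict_irrefl pred_below_carrier by blast+
  then show "k \<in> unit_component"
    using comparable_if_outside_unit_component[of \<one> k] by (auto simp: unit_component_iff)
qed

lemma pred_kernel_unit_component:
  "pred_kernel (G\<lparr>carrier := unit_component\<rparr>) (Restr r unit_component) = pred_kernel G r"
proof -
  have one: "\<one> \<in> unit_component"
    by (simp add: unit_component_iff)
  have "k \<in> pred_kernel (G\<lparr>carrier := unit_component\<rparr>) (Restr r unit_component) \<longleftrightarrow>
      k \<in> unit_component \<and> k \<lesssim> \<one> \<and> \<one> \<lesssim> k" for k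
  proof (cases "k \<in> unit_component")
    case True
    then show ?thesis
      using pred_rel_unit_component_iff[of k \<one>] pred_rel_unit_component_iff[of \<one> k] one
      by (auto simp: pred_kernel_def)
  qed (auto simp: pred_kernel_def pred_rel_def)
  then show ?thesis
    using pred_kernel_subset_unit_component by (auto simp: mem_pred_kernel_iff)
qed

text \<open>Translating by \<open>y\<inverse>\<close> reduces the comparison of \<open>x\<close> and \<open>y\<close> to that of \<open>x y\<inverse>\<close> and \<open>\<one>\<close>.
  If \<open>x y\<inverse>\<close> lies outside the component, then it is already comparable to \<open>\<one>\<close> for \<open>\<le>\<close>.\<close>

lemma pred_total_unit_component_iff:
  "total_on unit_component (pred_rel unit_component (Restr r unit_component)) \<longleftrightarrow>
     total_on (carrier G) (pred_rel (carrier G) r)" (is "?L \<longleftrightarrow> ?R")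
proof
  assume ?R
  moreover have "unit_component \<subseteq> carrier G"
    by (rule subgroup.subset[OF unit_component_subgroup])
  ultimately show ?L
    using pred_rel_unit_component_iff unfolding total_on_def pred_below_def by blast
next
  assume L: ?L
  have one: "\<one> \<in> unit_component"
    by (simp add: unit_component_iff)
  have "x \<lesssim> y \<or> y \<lesssim> x" if xy: "x \<in> carrier G" "y \<in> carrier G" for x y
  proof -
    let ?q = "x \<otimes> inv y"
    have "?q \<lesssim> \<one> \<or> \<one> \<lesssim> ?q"
    proof (cases "?q \<in> unit_component")
      case True
      then show ?thesis
        using L one pred_rel_unit_component_iff[of ?q \<one>] pred_rel_unit_component_iff[of \<one> ?q]
          pred_below_refl[of \<one>]
        unfolding total_on_def by (cases "?q = \<one>") auto
    next
      case False
      then show ?thesis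
        using comparable_if_outside_unit_component one xy strict_imp_pred_below by blast
    qed
    then show ?thesis
      using pred_right_iff[of y ?q \<one>] pred_right_iff[of y \<one> ?q] xy by (simp add: m_assoc)
  qed
  then show ?R
    by (simp add: pred_total_on_iff)
qed

end

section \<open>Semiorders and threshold groups\<close>

theorem theorem16:
  fixes G :: "('a, 'b) monoid_scheme" and r :: "'a rel"
  defines "K \<equiv> pred_kernel G r"
    and "I \<equiv> incomparability_component (carrier G) r \<one>\<^bsub>G\<^esub>"
  assumes "ordered_group G r"
  shows "(semiorder_on (carrier G) r \<longleftrightarrow>
            threshold_group (G\<lparr>carrier := I\<rparr> Mod K)
              (quotient_order (G\<lparr>carrier := I\<rparr>) K (Restr r I)))
       \<and> (semiorder_on (carrier G) r \<longleftrightarrow>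
            threshold_group (G Mod K) (quotient_order G K r))"
proof -
  interpret ordered_group G r by fact
  have I: "I = unit_component"
    by (simp add: I_def unit_component_def)
  interpret I: ordered_group "G\<lparr>carrier := I\<rparr>" "Restr r I"
    unfolding I by (rule restricted_ordered_group[OF unit_component_subgroup])
  have "pred_kernel (G\<lparr>carrier := I\<rparr>) (Restr r I) = K"
    unfolding I K_def by (rule pred_kernel_unit_component)
  then have "threshold_group (G\<lparr>carrier := I\<rparr> Mod K)
      (quotient_order (G\<lparr>carrier := I\<rparr>) K (Restr r I)) \<longleftrightarrow>
    total_on (carrier G) (pred_rel (carrier G) r)"
    using I.threshold_quotient_iff_pred_total pred_total_unit_component_iff by (simp add: I)
  then show ?thesis
    using semiorder_iff_pred_total threshold_quotient_iff_pred_total by (simp add: K_def)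
qed

end
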